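(* There is a function $f_2$ on the integers with $f_2(d)=\frac{3\sqrt2}{8}d^{3/2}+O(\sqrt d)$ as $d\to\infty$ such that the following holds. For every fixed $d\ge 3$ and all $n$, there exists a graph $G$ of order $n$ and diameter $d$ with $$W(G)\ge \frac d2 n^2 - f_2(d)\, n^{3/2} - O_d(n)\quad\text{as } n\to\infty.$$
   Context: Graphs are finite, simple and undirected. The Wiener index is $W(G)=\sum_{\{u,v\}\subset V(G)} d(u,v)$ over unordered pairs of distinct vertices, $d(u,v)$ being graph distance; the diameter is the maximum distance. $f_2(d)=\frac{3\sqrt2}{8}d^{3/2}+O(\sqrt d)$ means $|f_2(d)-\frac{3\sqrt2}{8}d^{3/2}|\le M\sqrt d$ for some constant $M$ and all $d\ge d_0$. The lower bound with $-O_d(n)$ means: for each $d$ there are constants $n_0(d),M(d)$ such that for all $n\ge n_0(d)$ such a graph exists with $W(G)\ge \frac d2 n^2-f_2(d)n^{3/2}-M(d)n$. *)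

theory Defs
  imports Complex_Main "Graph_Theory.Graph_Theory"
begin

text \<open>
  Finite simple undirected graphs are the \<^locale>\<open>pair_graph\<close>s of the AFP entry
  Graph_Theory: finite vertex set, and an irreflexive symmetric arc relation, so
  that an undirected edge is a pair of opposite arcs.
\<close>

text \<open>Every arc has weight 1; vertices in different components are at distance \<open>\<infinity>\<close>.\<close>

definition graph_dist :: "'a pair_pre_digraph \<Rightarrow> 'a \<Rightarrow> 'a \<Rightarrow> ereal" where
  "graph_dist G u v = wf_digraph.\<mu> (with_proj G) (\<lambda>_. 1) u v"

definition graph_diameter :: "'a pair_pre_digraph \<Rightarrow> ereal" where
  "graph_diameter G = Max {graph_dist G u v |u v. u \<in> pverts G \<and> v \<in> pverts G}"

text \<open>
  The sum ranges over the two-element sets of vertices; the description is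
  well-defined because distance is symmetric, see \<open>graph_dist_pair\<close> and
  \<open>wiener_index_ordered\<close> below.
\<close>

definition wiener_index :: "'a pair_pre_digraph \<Rightarrow> ereal" where
  "wiener_index G =
     (\<Sum>P | P \<subseteq> pverts G \<and> card P = 2. THE x. \<exists>u v. P = {u, v} \<and> x = graph_dist G u v)"

lemma graph_dist_commute:
  assumes "pair_graph G"
  shows "graph_dist G u v = graph_dist G v u"
proof -
  interpret pair_graph G by fact
  have rev_len: "length (rev_path p) = length p" for p :: "('a \<times> 'a) awalk"
    by (induct p) auto
  have cost: "awalk_cost (\<lambda>_. 1) p = real (length p)" for p :: "('a \<times> 'a) awalk"
    by (induct p) auto
  have "{ereal (awalk_cost (\<lambda>_. 1) p) |p. awalk x p y} \<subseteq>
        {ereal (awalk_cost (\<lambda>_. 1) p) |p. awalk y p x}" for x y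
  proof safe
    fix p assume "awalk x p y"
    then have "awalk y (rev_path p) x" by simp
    then show "\<exists>q. ereal (awalk_cost (\<lambda>_. 1) p) = ereal (awalk_cost (\<lambda>_. 1) q) \<and> awalk y q x"
      by (metis cost rev_len)
  qed
  then have "{ereal (awalk_cost (\<lambda>_. 1) p) |p. awalk u p v} =
             {ereal (awalk_cost (\<lambda>_. 1) p) |p. awalk v p u}"
    by blast
  then show ?thesis
    unfolding graph_dist_def \<mu>_def by (simp add: image_Collect)
qed

lemma graph_dist_pair:
  assumes "pair_graph G"
  shows "(THE x. \<exists>a b. {u, v} = {a, b} \<and> x = graph_dist G a b) = graph_dist G u v"
  using graph_dist_commute[OF assms] by (intro the_equality) (auto simp: doubleton_eq_iff)

lemma wiener_index_ordered:
  assumes "pair_graph G"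
  shows "(\<Sum>(u, v) | u \<in> pverts G \<and> v \<in> pverts G \<and> u \<noteq> v. graph_dist G u v)
         = wiener_index G + wiener_index G"
proof -
  interpret pair_graph G by fact
  let ?A = "{(u, v). u \<in> pverts G \<and> v \<in> pverts G \<and> u \<noteq> v}"
  let ?B = "{P. P \<subseteq> pverts G \<and> card P = 2}"
  let ?f = "\<lambda>(u, v). {u, v}"
  let ?g = "\<lambda>P. THE x. \<exists>u v. P = {u, v} \<and> x = graph_dist G u v"
  have finA: "finite ?A"
    by (rule finite_subset[of _ "pverts G \<times> pverts G"]) (auto simp: pair_finite_verts)
  have finB: "finite ?B"
    using pair_finite_verts by simp
  have "sum (\<lambda>(u, v). graph_dist G u v) ?A =
        (\<Sum>P\<in>?B. sum (\<lambda>(u, v). graph_dist G u v) {q \<in> ?A. ?f q = P})"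
    by (rule sum.group[symmetric, OF finA finB]) (auto simp: card_2_iff)
  also have "\<dots> = (\<Sum>P\<in>?B. ?g P + ?g P)"
  proof (rule sum.cong[OF refl])
    fix P assume "P \<in> ?B"
    then obtain a b where ab: "P = {a, b}" "a \<noteq> b" "a \<in> pverts G" "b \<in> pverts G"
      by (auto simp: card_2_iff)
    then have "{q \<in> ?A. ?f q = P} = {(a, b), (b, a)}"
      by (auto simp: doubleton_eq_iff)
    then have "sum (\<lambda>(u, v). graph_dist G u v) {q \<in> ?A. ?f q = P} =
               graph_dist G a b + graph_dist G a b"
      using ab graph_dist_commute[OF assms, of a b] by simp
    then show "sum (\<lambda>(u, v). graph_dist G u v) {q \<in> ?A. ?f q = P} = ?g P + ?g P"
      using graph_dist_pair[OF assms, of a b] ab(1) by simp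
  qed
  also have "\<dots> = wiener_index G + wiener_index G"
    unfolding wiener_index_def by (rule sum.distrib)
  finally show ?thesis .
qed

end

theory Submission
  imports Defs
begin

text \<open>
  Write \<open>d = 2h + e\<close> with \<open>e\<close> either 0 or 1. Take \<open>k\<close> branches, each a path of length \<open>h\<close> whose
  upper end is blown up to a clique of about \<open>n/k\<close> vertices, and join the lower ends so that
  vertices of heights \<open>i\<close> and \<open>j\<close> on different branches are at distance \<open>i + j + e\<close>: for odd \<open>d\<close>
  the lower ends form a clique, for even \<open>d\<close> they act as copies of a single centre. Almost all pairs
  of vertices are then at distance \<open>d\<close>. Pairs on a common branch cost at most \<open>dn\<^sup>2/(2k)\<close>, pairs
  involving a path vertex about \<open>d\<^sup>2nk/8\<close>, and \<open>k\<close> close to \<open>2 sqrt (n/d)\<close> yields a total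
  loss of about \<open>d\<^bsup>3/2\<^esup>n\<^bsup>3/2\<^esup>/2\<close>; the coefficient \<open>1/2\<close> is below \<open>3 sqrt 2/8\<close>.
\<close>

section \<open>Bounding graph distance by potentials and by walks\<close>

lemma (in wf_digraph) awalk_cost_one: "awalk_cost (\<lambda>_. 1) p = real (length p)"
  by (induct p) auto

text \<open>By induction along the walk: \<open>D\<close> drops by at most one per arc and vanishes
  at the target, so no walk is shorter than \<open>D u v\<close>. If there is no walk, the infimum
  is infinite.\<close>

lemma graph_dist_ge:
  fixes D :: "'a \<Rightarrow> 'a \<Rightarrow> nat"
  assumes "pair_wf_digraph G"
    and refl: "\<And>v. D v v = 0"
    and step: "\<And>u v w. (u, v) \<in> parcs G \<Longrightarrow> D u w \<le> Suc (D v w)"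
  shows "ereal (real (D u v)) \<le> graph_dist G u v"
proof -
  interpret pair_wf_digraph G by fact
  have "D u v \<le> length p" if "awalk u p v" for p
    using that
  proof (induct p arbitrary: u)
    case Nil
    then show ?case by (simp add: awalk_Nil_iff refl)
  next
    case (Cons e p)
    then have "e \<in> parcs G" "u = fst e" "awalk (snd e) p v"
      by (auto simp: awalk_Cons_iff)
    with Cons.hyps[of "snd e"] step[of u "snd e" v] show ?case by simp
  qed
  then show ?thesis
    unfolding graph_dist_def \<mu>_def by (intro INF_greatest) (simp add: awalk_cost_one)
qed

lemma graph_dist_le:
  assumes "pair_wf_digraph G" "pre_digraph.awalk (with_proj G) u p v" "length p \<le> m"
  shows "graph_dist G u v \<le> ereal (real m)"
proof -
  interpret pair_wf_digraph G by fact
  have "graph_dist G u v \<le> ereal (awalk_cost (\<lambda>_. 1) p)"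
    unfolding graph_dist_def by (rule min_cost_le_walk_cost) fact
  also have "\<dots> \<le> ereal (real m)"
    using assms(3) by (simp add: awalk_cost_one)
  finally show ?thesis .
qed

section \<open>The branch graph and its distances\<close>

text \<open>
  Vertex \<open>v\<close> lies on branch \<open>v mod k\<close>. On each branch there is
  one vertex at every height below \<open>h\<close>; all the other vertices of the branch have height \<open>h\<close>.
\<close>

definition height :: "nat \<Rightarrow> nat \<Rightarrow> nat \<Rightarrow> nat" where
  "height h k v = min h (v div k)"

text \<open>Subtraction on naturals truncates, so the sum of the two differences is the absolute
  difference of the heights.\<close>

definition branch_dist :: "nat \<Rightarrow> nat \<Rightarrow> nat \<Rightarrow> nat \<Rightarrow> nat \<Rightarrow> nat" where
  "branch_dist h e k u v =
     (if u mod k = v mod k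
      then (height h k u - height h k v) + (height h k v - height h k u)
      else height h k u + height h k v + e)"

text \<open>
  The vertices of height \<open>h\<close> on one branch, and for \<open>e = 0\<close> also the lower ends of the branches, are
  at \<open>branch_dist\<close> 0 but adjacent, so that graph distance can exceed \<open>branch_dist\<close>.
\<close>

definition branch_graph :: "nat \<Rightarrow> nat \<Rightarrow> nat \<Rightarrow> nat \<Rightarrow> nat pair_pre_digraph" where
  "branch_graph h e k n =
     \<lparr>pverts = {..<n},
      parcs = {(u, v). u < n \<and> v < n \<and> u \<noteq> v \<and> branch_dist h e k u v \<le> 1}\<rparr>"

lemma branch_graph_simps [simp]:
  "pverts (branch_graph h e k n) = {..<n}"
  "(u, v) \<in> parcs (branch_graph h e k n) \<longleftrightarrow>
     u < n \<and> v < n \<and> u \<noteq> v \<and> branch_dist h e k u v \<le> 1"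
  by (auto simp: branch_graph_def)

lemma branch_dist_self [simp]: "branch_dist h e k v v = 0"
  by (simp add: branch_dist_def)

lemma branch_dist_commute: "branch_dist h e k u v = branch_dist h e k v u"
  by (simp add: branch_dist_def)

lemma branch_dist_triangle:
  "branch_dist h e k u w \<le> branch_dist h e k u v + branch_dist h e k v w"
  by (auto simp: branch_dist_def)

lemma branch_dist_le: "branch_dist h e k u v \<le> 2 * h + e"
  by (auto simp: branch_dist_def height_def)

lemma pair_graph_branch_graph: "pair_graph (branch_graph h e k n)"
proof
  show "finite (parcs (branch_graph h e k n))"
    by (rule finite_subset[of _ "{..<n} \<times> {..<n}"]) (auto simp: branch_graph_def)
  show "symmetric (with_proj (branch_graph h e k n))"
    by (auto simp: symmetric_def sym_def branch_dist_commute)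
qed auto

text \<open>Arcs join vertices at \<open>branch_dist\<close> at most 1, so by the triangle
  inequality \<open>branch_dist\<close> to a fixed target is a potential as in
  \<open>graph_dist_ge\<close>.\<close>

lemma branch_dist_le_graph_dist:
  "ereal (real (branch_dist h e k u v)) \<le> graph_dist (branch_graph h e k n) u v"
proof (rule graph_dist_ge)
  show "pair_wf_digraph (branch_graph h e k n)"
    using pair_graph_branch_graph by (simp add: pair_graph_def pair_digraph_def pair_fin_digraph_def)
  show "branch_dist h e k u w \<le> Suc (branch_dist h e k v w)"
    if "(u, v) \<in> parcs (branch_graph h e k n)" for u v w
    using that branch_dist_triangle[of h e k u w v] by simp
qed simp

lemma lower_neighbour:
  assumes "height h k u > 0" "k > 0" "u < n"
  obtains w where "w < n" "w mod k = u mod k" "Suc (height h k w) = height h k u"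
    "(u, w) \<in> parcs (branch_graph h e k n)"
proof
  define j where "j = height h k u - 1"
  \<comment> \<open>The only vertex of height \<open>j\<close> on the branch of \<open>u\<close>.
    Its number is at most \<open>u\<close>, so it belongs to the graph.\<close>
  let ?w = "k * j + u mod k"
  have j: "Suc j = height h k u" "j < h" "j < u div k"
    using assms(1) by (auto simp: j_def height_def)
  have "?w div k = j"
    using assms(2) by simp
  then show hw: "Suc (height h k ?w) = height h k u"
    using j by (simp add: height_def)
  show mw: "?w mod k = u mod k"
    by simp
  have "k * j \<le> k * (u div k)"
    using j by simp
  then have "?w \<le> u"
    using mult_div_mod_eq[of k u] by linarith
  then show wn: "?w < n"
    using assms(3) by simp
  show "(u, ?w) \<in> parcs (branch_graph h e k n)"
    using hw mw wn assms(3) by (auto simp: branch_dist_def)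
qed

text \<open>Strong induction on \<open>branch_dist\<close>, moving the higher end down its branch.
  The maximum with 1 covers distinct vertices at \<open>branch_dist\<close> 0, which are
  adjacent.\<close>

lemma branch_graph_awalk:
  assumes "k > 0" "e \<le> 1" "u < n" "v < n"
  shows "\<exists>p. pre_digraph.awalk (with_proj (branch_graph h e k n)) u p v
    \<and> length p \<le> max 1 (branch_dist h e k u v)"
proof -
  interpret pair_graph "branch_graph h e k n" by (rule pair_graph_branch_graph)
  have arc: "\<exists>p. awalk u p v \<and> length p \<le> 1"
    if "branch_dist h e k u v \<le> 1" "u < n" "v < n" for u v
  proof (cases "u = v")
    case True
    then have "awalk u [] v" using that by (simp add: awalk_Nil_iff)
    then show ?thesis by fastforce
  next
    case False
    then have "awalk u [(u, v)] v" using that by (simp add: awalk_simps)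
    then show ?thesis by fastforce
  qed
  \<comment> \<open>At \<open>branch_dist\<close> at least 2, stepping down from the higher end shortens the distance.\<close>
  have down: "\<exists>w. w < n \<and> (u, w) \<in> parcs (branch_graph h e k n)
      \<and> Suc (branch_dist h e k w v) = branch_dist h e k u v"
    if D: "branch_dist h e k u v \<ge> 2" and uv: "height h k v \<le> height h k u" and u: "u < n" for u v
  proof -
    \<comment> \<open>Otherwise both heights are 0 and \<open>branch_dist\<close> is at most
      \<open>e \<le> 1\<close>.\<close>
    have "height h k u > 0"
      using D uv assms(2) by (auto simp: branch_dist_def split: if_splits)
    from lower_neighbour[OF this assms(1) u, of e] obtain w
      where w: "w < n" "w mod k = u mod k" "Suc (height h k w) = height h k u"
        "(u, w) \<in> parcs (branch_graph h e k n)" .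
    have "Suc (branch_dist h e k w v) = branch_dist h e k u v"
      using w(2,3) D uv by (auto simp: branch_dist_def split: if_splits)
    with w show ?thesis by blast
  qed
  show ?thesis
    using assms(3,4)
  proof (induct "branch_dist h e k u v" arbitrary: u v rule: less_induct)
    case less
    show ?case
    proof (cases "branch_dist h e k u v \<le> 1")
      case True
      with arc less.prems show ?thesis by fastforce
    next
      case False
      then have D: "branch_dist h e k u v \<ge> 2" by simp
      show ?thesis
      proof (cases "height h k v \<le> height h k u")
        case True
        from down[OF D this less.prems(1)] obtain w
          where w: "w < n" "(u, w) \<in> parcs (branch_graph h e k n)"
            "Suc (branch_dist h e k w v) = branch_dist h e k u v" by blast
        with less.hyps[of w v] less.prems obtain p
          where "awalk w p v" "length p \<le> max 1 (branch_dist h e k w v)" by auto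
        then have "awalk u ((u, w) # p) v" "length ((u, w) # p) \<le> max 1 (branch_dist h e k u v)"
          using w D by (auto simp: awalk_Cons_iff)
        then show ?thesis by blast
      next
        case False
        have D': "branch_dist h e k v u \<ge> 2" using D by (simp add: branch_dist_commute)
        from False have "height h k u \<le> height h k v" by simp
        from down[OF D' this less.prems(2)] obtain w
          where w: "w < n" "(v, w) \<in> parcs (branch_graph h e k n)"
            "Suc (branch_dist h e k u w) = branch_dist h e k u v"
          by (auto simp: branch_dist_commute)
        with less.hyps[of u w] less.prems obtain p
          where p: "awalk u p w" "length p \<le> max 1 (branch_dist h e k u w)" by auto
        have "awalk w [(w, v)] v"
          using w by (auto simp: awalk_simps branch_dist_commute)
        from awalk_appendI[OF p(1) this] have "awalk u (p @ [(w, v)]) v" .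
        moreover have "length (p @ [(w, v)]) \<le> max 1 (branch_dist h e k u v)"
          using p(2) w D by auto
        ultimately show ?thesis by blast
      qed
    qed
  qed
qed

section \<open>The diameter\<close>

lemma graph_diameter_branch_graph:
  assumes "h \<ge> 1" "e \<le> 1" "k \<ge> 2" "n \<ge> k * (h + 1)"
  shows "graph_diameter (branch_graph h e k n) = ereal (real (2 * h + e))"
proof -
  let ?G = "branch_graph h e k n"
  let ?S = "{graph_dist ?G u v |u v. u \<in> pverts ?G \<and> v \<in> pverts ?G}"
  have wf: "pair_wf_digraph ?G"
    using pair_graph_branch_graph by (simp add: pair_graph_def pair_digraph_def pair_fin_digraph_def)
  have le: "graph_dist ?G u v \<le> ereal (real (2 * h + e))" if "u < n" "v < n" for u v
  proof -
    from branch_graph_awalk[of k e u n v h] assms that obtain p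
      where "pre_digraph.awalk (with_proj ?G) u p v" "length p \<le> max 1 (branch_dist h e k u v)"
      by auto
    \<comment> \<open>Here \<open>h \<ge> 1\<close> absorbs the extra 1 of adjacent vertices at
      \<open>branch_dist\<close> 0.\<close>
    moreover have "max 1 (branch_dist h e k u v) \<le> 2 * h + e"
      using assms(1) branch_dist_le[of h e k u v] by simp
    ultimately show ?thesis
      by (intro graph_dist_le[OF wf]) auto
  qed
  \<comment> \<open>The first vertices of height \<open>h\<close> on branches 0 and 1;
    \<open>k \<ge> 2\<close> makes these branches different.\<close>
  let ?u = "k * h" and ?v = "k * h + 1"
  have lt: "?u < n" "?v < n"
    using assms(3,4) by (auto simp: algebra_simps)
  have "?u div k = h" "?u mod k = 0" "?v div k = h" "?v mod k = 1"
    using assms(3) by (simp_all del: add_Suc_right One_nat_def)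
  then have "height h k ?u = h" "height h k ?v = h" "?u mod k = 0" "?v mod k = 1"
    by (simp_all add: height_def)
  then have "branch_dist h e k ?u ?v = 2 * h + e"
    by (simp add: branch_dist_def)
  with branch_dist_le_graph_dist[of h e k ?u ?v n] le[OF lt]
  have eq: "graph_dist ?G ?u ?v = ereal (real (2 * h + e))"
    by (metis antisym)
  have "finite ?S"
  proof (rule finite_subset)
    show "?S \<subseteq> (\<lambda>(u, v). graph_dist ?G u v) ` ({..<n} \<times> {..<n})" by auto
  qed simp
  then show ?thesis
    unfolding graph_diameter_def
  proof (rule Max_eqI)
    show "y \<le> ereal (real (2 * h + e))" if "y \<in> ?S" for y
      using that le by auto
    show "ereal (real (2 * h + e)) \<in> ?S"
      by (intro CollectI exI conjI, rule eq[symmetric]) (use lt in simp_all)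
  qed
qed

section \<open>Lower bound for the Wiener index of the branch graph\<close>

lemma sum_height_deficit:
  assumes "k * h \<le> n" "k > 0"
  shows "2 * (\<Sum>v<n. h - height h k v) = k * (h * (h + 1))"
proof -
  have "(\<Sum>v<n. h - height h k v) = (\<Sum>v<k * h. h - height h k v)"
  proof (rule sum.mono_neutral_right)
    show "\<forall>v\<in>{..<n} - {..<k * h}. h - height h k v = 0"
      using assms(2) by (auto simp: height_def not_less less_eq_div_iff_mult_less_eq mult.commute)
  qed (use assms in auto)
  also have "\<dots> = (\<Sum>v<k * h. h - v div k)"
    by (rule sum.cong) (auto simp: height_def)
  also have "\<dots> = (\<Sum>i<h. k * (h - i))"
  proof -
    \<comment> \<open>The number \<open>m\<close> of blocks of \<open>k\<close> consecutive vertices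
      is decoupled from the \<open>h\<close> in the summand, to allow induction on
      \<open>m\<close>.\<close>
    have "(\<Sum>v<k * m. h - v div k) = (\<Sum>i<m. k * (h - i))" for m
    proof (induct m)
      case (Suc m)
      have "(\<Sum>v<k * Suc m. h - v div k)
          = (\<Sum>v<k * m. h - v div k) + (\<Sum>v=k*m..<k*m+k. h - v div k)"
        by (simp add: lessThan_atLeast0 sum.atLeastLessThan_concat add.commute)
      also have "(\<Sum>v=k*m..<k*m+k. h - v div k) = (\<Sum>v=k*m..<k*m+k. h - m)"
      proof (rule sum.cong)
        fix v assume "v \<in> {k*m..<k*m+k}"
        then have "v div k = m"
          by (intro div_nat_eqI) (auto simp: algebra_simps)
        then show "h - v div k = h - m" by simp
      qed simp
      finally show ?case using Suc by simp
    qed simp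
    then show ?thesis .
  qed
  also have "2 * \<dots> = k * (h * (h + 1))"
  proof -
    have "(\<Sum>i<h. h - i) = (\<Sum>i<h. Suc i)"
      by (rule sum.reindex_bij_witness[of _ "\<lambda>i. h - Suc i" "\<lambda>i. h - Suc i"]) auto
    moreover have "2 * (\<Sum>i<h. Suc i) = h * (h + 1)" for h
      by (induct h) auto
    ultimately show ?thesis
      by (simp flip: sum_distrib_left)
  qed
  finally show ?thesis .
qed

text \<open>Within a residue class the quotient by \<open>k\<close> determines the vertex. This
  bounds the size of a branch.\<close>

lemma card_residue_class_le:
  assumes "k > 0"
  shows "card {v. v < n \<and> v mod k = r} \<le> n div k + 1"
proof -
  have "card {v. v < n \<and> v mod k = r} \<le> card {..n div k}"
  proof (rule card_inj_on_le)
    show "inj_on (\<lambda>v. v div k) {v. v < n \<and> v mod k = r}"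
      by (intro inj_onI) (metis (mono_tags, lifting) mem_Collect_eq mult_div_mod_eq)
    show "(\<lambda>v. v div k) ` {v. v < n \<and> v mod k = r} \<subseteq> {..n div k}"
      by (auto intro: div_le_mono)
  qed simp
  then show ?thesis by simp
qed

lemma sum_branch_dist_ge:
  assumes "k * h \<le> n" "k > 0"
  shows "(\<Sum>u<n. \<Sum>v<n. real (branch_dist h e k u v)) \<ge>
    real (2 * h + e) * real n ^ 2 - real n * k * real (h * (h + 1))
      - real (2 * h + e) * (real n ^ 2 / k + n)"
proof -
  let ?d = "real (2 * h + e)"
  let ?def = "\<lambda>v. real (h - height h k v)"
  let ?same = "\<lambda>u v. if v mod k = u mod k then 1 else 0 :: real"
  \<comment> \<open>On different branches this is an equality. On the same branch the left side is
    at most 0. Summed over ordered pairs, the two deficits together cost \<open>n\<close> times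
    twice the deficit sum, and each vertex shares its branch with at most \<open>n / k + 1\<close>
    vertices, itself included.\<close>
  have pointwise: "?d - ?def u - ?def v - ?d * ?same u v \<le> real (branch_dist h e k u v)" for u v
    by (auto simp: branch_dist_def height_def)
  have def_sum: "2 * (\<Sum>v<n. ?def v) = real k * (h * (h + 1))"
    using sum_height_deficit[OF assms] by (metis of_nat_mult of_nat_numeral of_nat_sum)
  have same_sum: "(\<Sum>v<n. ?same u v) \<le> real n / k + 1" for u
  proof -
    have "(\<Sum>v<n. ?same u v) = real (card {v. v < n \<and> v mod k = u mod k})"
      by (simp add: sum.If_cases Int_def)
    also have "\<dots> \<le> real (n div k + 1)"
      using card_residue_class_le[OF assms(2)] of_nat_le_iff by blast
    also have "\<dots> \<le> real n / k + 1"
      using of_nat_div_le_of_nat[of n k] by simp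
    finally show ?thesis .
  qed
  have "?d * real n ^ 2 - real n * k * real (h * (h + 1)) - ?d * (real n ^ 2 / k + n)
      = (\<Sum>u<n. real n * ?d - (\<Sum>v<n. ?def v) - n * ?def u - ?d * (real n / k + 1))"
    by (simp add: sum_subtractf flip: sum_distrib_left)
      (use def_sum in \<open>simp add: algebra_simps power2_eq_square\<close>)
  also have "\<dots> \<le> (\<Sum>u<n. real n * ?d - (\<Sum>v<n. ?def v) - n * ?def u - ?d * (\<Sum>v<n. ?same u v))"
    using same_sum by (intro sum_mono diff_left_mono mult_left_mono) auto
  also have "\<dots> = (\<Sum>u<n. \<Sum>v<n. ?d - ?def u - ?def v - ?d * ?same u v)"
    by (simp add: sum_subtractf sum.distrib sum_distrib_left algebra_simps)
  also have "\<dots> \<le> (\<Sum>u<n. \<Sum>v<n. real (branch_dist h e k u v))"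
    by (intro sum_mono pointwise)
  finally show ?thesis .
qed

text \<open>The diagonal contributes 0, and summing over ordered pairs counts every unordered pair
  twice, whence the factor 1/2.\<close>

lemma wiener_index_branch_graph_ge:
  "ereal ((\<Sum>u<n. \<Sum>v<n. real (branch_dist h e k u v)) / 2) \<le> wiener_index (branch_graph h e k n)"
proof -
  let ?G = "branch_graph h e k n" and ?D = "\<lambda>u v. real (branch_dist h e k u v)"
  let ?A = "{(u, v). u < n \<and> v < n \<and> u \<noteq> v}"
  let ?s = "\<Sum>u<n. \<Sum>v<n. ?D u v"
  have "?s = (\<Sum>(u, v)\<in>{..<n} \<times> {..<n}. ?D u v)"
    by (simp add: sum.cartesian_product)
  also have "\<dots> = (\<Sum>(u, v)\<in>?A. ?D u v)"
    by (rule sum.mono_neutral_right) auto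
  finally have "ereal ?s = (\<Sum>(u, v)\<in>?A. ereal (?D u v))"
    by (simp add: case_prod_unfold)
  also have "\<dots> \<le> (\<Sum>(u, v)\<in>?A. graph_dist ?G u v)"
    by (intro sum_mono) (auto intro: branch_dist_le_graph_dist)
  also have "\<dots> = wiener_index ?G + wiener_index ?G"
    using wiener_index_ordered[OF pair_graph_branch_graph, of h e k n] by simp
  finally show ?thesis
    by (cases "wiener_index ?G") auto
qed

section \<open>Choosing the number of branches and estimating the loss\<close>

lemma exists_graph_wiener_index_ge:
  assumes "d \<ge> 3" "n \<ge> 9 * (d + 1) ^ 2"
  shows "\<exists>G :: nat pair_pre_digraph. pair_graph G \<and> card (pverts G) = n \<and>
    graph_diameter G = ereal (real d) \<and>
    wiener_index G \<ge> ereal (real d / 2 * real n ^ 2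
      - (real d powr (3/2) / 2 + sqrt d / 2) * real n powr (3/2) - (real d ^ 2 + real d) * real n)"
proof -
  define h e where "h = d div 2" and "e = d mod 2"
  have d: "d = 2 * h + e" and h: "h \<ge> 1" and e: "e \<le> 1"
    using assms(1) by (auto simp: h_def e_def)
  define s x where "s = sqrt (real d)" and "x = sqrt (real n)"
  have s: "s\<^sup>2 = d" and x: "x\<^sup>2 = n"
    by (simp_all add: s_def x_def)
  have s1: "s \<ge> 1"
    using assms(1) by (simp add: s_def)
  have "(3 * (d + 1)) ^ 2 \<le> n"
    using assms(2) by (simp only: power_mult_distrib) simp
  then have "real (3 * (d + 1)) ^ 2 \<le> real n"
    by (metis of_nat_le_iff of_nat_power)
  then have x_ge: "real (3 * (d + 1)) \<le> x"
    unfolding x_def by (rule real_le_rsqrt)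
  then have x1: "x \<ge> 1"
    using of_nat_0_le_iff[of d, where ?'a = real] by simp
  then have x0: "x > 0"
    by simp
  have sx: "s \<le> x"
  proof -
    have "s * 1 \<le> s * s"
      using s1 by (intro mult_left_mono) auto
    then show ?thesis using x_ge s by (simp add: power2_eq_square)
  qed
  \<comment> \<open>Over ordered pairs the leading losses are \<open>n * k * d^2 / 4\<close> and
    \<open>d * n^2 / k\<close>. They balance at \<open>k = 2 * x / s\<close>, where each equals
    \<open>s^3 * x^3 / 2\<close>.\<close>
  define k where "k = nat \<lceil>2 * x / s\<rceil>"
  have k_ge: "2 * x / s \<le> k"
    unfolding k_def by (rule real_nat_ceiling_ge)
  have k_le: "k \<le> 2 * x / s + 1"
    using s1 x0 unfolding k_def by (simp add: of_nat_nat)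
  have "2 \<le> 2 * x / s"
    using sx s1 by (simp add: field_simps)
  then have k2: "k \<ge> 2"
    using k_ge by linarith
  \<comment> \<open>The bound \<open>9 * (d + 1) ^ 2\<close> on \<open>n\<close> is chosen for this:
    it makes \<open>h + 1\<close> at most \<open>x / 3\<close>, while \<open>k\<close> is at most
    \<open>3 * x\<close>.\<close>
  have kn: "k * (h + 1) \<le> n"
  proof -
    have "2 * x / s \<le> 2 * x"
      using s1 x0 by (simp add: field_simps)
    then have "real k \<le> 3 * x"
      using k_le x1 by linarith
    moreover have "real (h + 1) \<le> x / 3"
      using x_ge d by simp
    ultimately have "real k * real (h + 1) \<le> (3 * x) * (x / 3)"
      using x0 by (intro mult_mono) auto
    also have "\<dots> = n"
      using x by (simp add: power2_eq_square)
    finally show ?thesis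
      by (metis of_nat_le_iff of_nat_mult)
  qed
  let ?G = "branch_graph h e k n"
  let ?sum = "\<Sum>u<n. \<Sum>v<n. real (branch_dist h e k u v)"
  have lower: "?sum \<ge> real d * real n ^ 2 - real n * k * real (h * (h + 1)) - real d * (real n ^ 2 / k + n)"
    using sum_branch_dist_ge[of k h n e] kn k2 d by (simp add: algebra_simps)
  \<comment> \<open>The term \<open>s * x ^ 3\<close> comes from the \<open>d / 2\<close> in
    \<open>h * (h + 1) \<le> d^2 / 4 + d / 2\<close> and becomes the \<open>sqrt d / 2\<close> of
    the final coefficient. Rounding \<open>k\<close> up costs only a multiple of \<open>n\<close>;
    that multiple is enlarged so that, after adding \<open>d * n\<close> from the pairs on a common
    branch and halving, exactly \<open>d^2 + d\<close> remains.\<close>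
  have paths: "real n * k * real (h * (h + 1)) \<le> s ^ 3 * x ^ 3 / 2 + s * x ^ 3 + (2 * real d ^ 2 + real d) * n"
  proof -
    have hd: "real (h * (h + 1)) \<le> real d / 2 * (real d / 2 + 1)"
      unfolding of_nat_mult using d by (intro mult_mono) auto
    have "real n * k * real (h * (h + 1)) \<le> real n * (2 * x / s + 1) * (real d / 2 * (real d / 2 + 1))"
      by (rule mult_mono[OF mult_left_mono[OF k_le] hd]) (use x0 s1 in simp_all)
    also have "\<dots> = s ^ 3 * x ^ 3 / 2 + s * x ^ 3 + (real d ^ 2 / 4 + real d / 2) * n"
      using s1 by (simp add: field_simps power2_eq_square power3_eq_cube flip: s x)
    also have "\<dots> \<le> s ^ 3 * x ^ 3 / 2 + s * x ^ 3 + (2 * real d ^ 2 + real d) * n"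
      by (intro add_left_mono mult_right_mono add_mono) auto
    finally show ?thesis .
  qed
  have same: "real d * (real n ^ 2 / k + n) \<le> s ^ 3 * x ^ 3 / 2 + real d * n"
  proof -
    have "real n ^ 2 / k \<le> real n ^ 2 / (2 * x / s)"
      by (rule divide_left_mono[OF k_ge]) (use x0 s1 k2 in auto)
    then have "real d * (real n ^ 2 / k) \<le> real d * (real n ^ 2 / (2 * x / s))"
      by (rule mult_left_mono) simp
    also have "\<dots> = s ^ 3 * x ^ 3 / 2"
      using x0 s1 by (simp add: field_simps power2_eq_square power3_eq_cube flip: s x)
    finally show ?thesis
      by (simp add: distrib_left)
  qed
  have powr_sqrt: "real m powr (3/2) = sqrt m ^ 3" if "m > 0" for m :: nat
    using that by (simp add: powr_half_sqrt[symmetric] powr_powr flip: powr_realpow)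
  have "n > 0"
    using x0 x_def by simp
  have "real d / 2 * real n ^ 2 - (s ^ 3 / 2 + s / 2) * x ^ 3 - (real d ^ 2 + real d) * n \<le> ?sum / 2"
  proof -
    have "real d * real n ^ 2 - (s ^ 3 * x ^ 3 / 2 + s * x ^ 3 + (2 * real d ^ 2 + real d) * n)
        - (s ^ 3 * x ^ 3 / 2 + real d * n) \<le> ?sum"
      by (rule order_trans[OF diff_mono[OF diff_left_mono[OF paths] same] lower])
    then show ?thesis
      by (simp add: algebra_simps)
  qed
  then have "ereal (real d / 2 * real n ^ 2
      - (real d powr (3/2) / 2 + sqrt d / 2) * real n powr (3/2) - (real d ^ 2 + real d) * real n)
      \<le> ereal (?sum / 2)"
    using assms(1) \<open>n > 0\<close> by (simp add: powr_sqrt s_def x_def)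
  also have "\<dots> \<le> wiener_index ?G"
    by (rule wiener_index_branch_graph_ge)
  finally have "wiener_index ?G \<ge> ereal (real d / 2 * real n ^ 2
      - (real d powr (3/2) / 2 + sqrt d / 2) * real n powr (3/2) - (real d ^ 2 + real d) * real n)" .
  moreover have "graph_diameter ?G = ereal (real d)"
    using graph_diameter_branch_graph[OF h e k2 kn] d by simp
  ultimately show ?thesis
    using pair_graph_branch_graph[of h e k n] by (intro exI[of _ ?G]) simp
qed

section \<open>Comparison with the required coefficient\<close>

theorem theorem3p3:
  shows "\<exists>f2 :: int \<Rightarrow> real.
    (\<exists>(M :: real) (d0 :: int). \<forall>d \<ge> d0.
       \<bar>f2 d - 3 * sqrt 2 / 8 * of_int d powr (3/2)\<bar> \<le> M * sqrt (of_int d)) \<and>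
    (\<forall>d \<ge> 3. \<exists>(n0 :: nat) (M :: real). \<forall>n \<ge> n0. \<exists>G :: nat pair_pre_digraph.
       pair_graph G \<and> card (pverts G) = n \<and> graph_diameter G = ereal (of_int d) \<and>
       wiener_index G \<ge>
         ereal (of_int d / 2 * real n ^ 2 - f2 d * real n powr (3/2) - M * real n))"
proof (intro exI[of _ "\<lambda>d :: int. 3 * sqrt 2 / 8 * of_int d powr (3/2) + sqrt (of_int d)"]
    exI[of _ "1 :: real"] exI[of _ "0 :: int"] conjI allI impI)
  fix d :: int assume "d \<ge> 3"
  \<comment> \<open>This \<open>f2\<close> is the prescribed main term plus \<open>sqrt d\<close>,
    so the error bound holds with constant 1. The added \<open>sqrt d\<close> leaves room for the
    \<open>sqrt d / 2\<close> of the construction.\<close>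
  let ?f = "3 * sqrt 2 / 8 * of_int d powr (3/2) + sqrt (of_int d) :: real"
  define m where "m = nat d"
  have m: "m \<ge> 3" and d: "real_of_int d = real m"
    using \<open>d \<ge> 3\<close> by (auto simp: m_def)
  \<comment> \<open>Equivalent to \<open>1 / 2 \<le> 3 * sqrt 2 / 8\<close>, the comparison of the
    leading coefficients.\<close>
  have "4 / 3 \<le> sqrt (2 :: real)"
    by (rule real_le_rsqrt) (simp add: power2_eq_square)
  then have "real m powr (3/2) / 2 \<le> 3 * sqrt 2 / 8 * real m powr (3/2)"
    using mult_right_mono[of "1 / 2" "3 * sqrt 2 / 8" "real m powr (3/2)"] by simp
  then have "real m powr (3/2) / 2 + sqrt m / 2 \<le> ?f"
    using d by (intro add_mono) auto
  then have f: "(real m powr (3/2) / 2 + sqrt m / 2) * real n powr (3/2) \<le> ?f * real n powr (3/2)" for n :: nat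
    by (rule mult_right_mono) simp
  show "\<exists>(n0 :: nat) (M :: real). \<forall>n \<ge> n0. \<exists>G :: nat pair_pre_digraph.
      pair_graph G \<and> card (pverts G) = n \<and> graph_diameter G = ereal (of_int d) \<and>
      wiener_index G \<ge> ereal (of_int d / 2 * real n ^ 2 - ?f * real n powr (3/2) - M * real n)"
  proof (intro exI[of _ "9 * (m + 1) ^ 2"] exI[of _ "real m ^ 2 + real m"] allI impI)
    fix n assume "n \<ge> 9 * (m + 1) ^ 2"
    from exists_graph_wiener_index_ge[OF m this] obtain G :: "nat pair_pre_digraph"
      where G: "pair_graph G" "card (pverts G) = n" "graph_diameter G = ereal (of_int d)"
        "wiener_index G \<ge> ereal (real m / 2 * real n ^ 2
          - (real m powr (3/2) / 2 + sqrt m / 2) * real n powr (3/2) - (real m ^ 2 + real m) * real n)"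
      unfolding d by blast
    have "ereal (of_int d / 2 * real n ^ 2 - ?f * real n powr (3/2) - (real m ^ 2 + real m) * real n)
        \<le> wiener_index G"
      using f[of n] d by (intro order_trans[OF _ G(4)]) simp
    with G show "\<exists>G :: nat pair_pre_digraph.
        pair_graph G \<and> card (pverts G) = n \<and> graph_diameter G = ereal (of_int d) \<and>
        wiener_index G \<ge> ereal (of_int d / 2 * real n ^ 2 - ?f * real n powr (3/2)
          - (real m ^ 2 + real m) * real n)"
      by blast
  qed
qed simp

end
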